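(* Let $(W,S)$ be any Coxeter system (with $S$ finite) and let $i:S\to I$ be any function that is constant on conjugacy classes. Then both the standard growth series $\gamma(\mathbf{t})\in\mathbb{Q}[[\mathbf{t}]]$ and the standard complete growth series $\tilde\gamma(\mathbf{t})\in\mathbb{Q}[W][[\mathbf{t}]]$ are rational.
   Context: A Coxeter system $(W,S)$: $W=\langle S\mid (ss')^{m(s,s')}=1\rangle$ (one relation for each pair with $m(s,s')<\infty$), $m$ symmetric with values in $\{1,2,\dots,\infty\}$, $m(s,s')=1$ iff $s=s'$. "Constant on conjugacy classes" means $i(s)=i(s')$ whenever $s,s'\in S$ are conjugate in $W$. $\mathbf{t}=(t_i)_{i\in I}$ is a tuple of commuting indeterminates. For $w\in W$ with reduced expression $w=s_1\cdots s_n$ ($s_j\in S$, $n$ minimal), put $t^w=\prod_{j=1}^n t_{i(s_j)}$, which does not depend on the reduced expression chosen. $\mathbb{Q}[W]$ is the group ring, and $\mathbb{Q}[W][[\mathbf{t}]]$ is the ring of formal power series in the $t_i$ (commuting with each other and with coefficients) with coefficients in $\mathbb{Q}[W]$. The series are $$\gamma(\mathbf{t})=\sum_{w\in W}t^w,\qquad \tilde\gamma(\mathbf{t})=\sum_{w\in W}w\,t^w.$$ For $R=\mathbb{Q}$ or $R=\mathbb{Q}[W]$, a series in $R[[\mathbf{t}]]$ is rational if it can be obtained from finitely many polynomials in $R[\mathbf{t}]$ by a finite sequence of additions, multiplications and quasi-inversions, where the quasi-inverse of a series $\lambda$ with zero constant term is $\lambda^+=\sum_{n\ge1}\lambda^n$.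 *)

theory Defs
  imports
    Complex_Main
    "HOL-Library.Extended_Nat"
    "HOL-Library.Groups_Big_Fun"
    "HOL-Library.Poly_Mapping"
begin

section \<open>Formal power series in commuting indeterminates\<close>

text \<open>
  The indeterminates are indexed by a type \<open>'i\<close>, and a monomial is its exponent vector, of type
  \<open>'i \<Rightarrow>\<^sub>0 nat\<close>. The coefficient ring \<open>'r\<close> need not be commutative; coefficients commute with
  the indeterminates.
\<close>

typedef ('i, 'r) mps = "UNIV :: (('i \<Rightarrow>\<^sub>0 nat) \<Rightarrow> 'r) set"
  morphisms mps_coeff Abs_mps ..

lemma mps_coeff_Abs [simp]: "mps_coeff (Abs_mps f) = f"
  by (simp add: Abs_mps_inverse)

lemma mps_eqI: "(\<And>m. mps_coeff f m = mps_coeff g m) \<Longrightarrow> f = g"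
  by (metis ext mps_coeff_inject)

definition splittings :: "('i \<Rightarrow>\<^sub>0 nat) \<Rightarrow> (('i \<Rightarrow>\<^sub>0 nat) \<times> ('i \<Rightarrow>\<^sub>0 nat)) set" where
  "splittings m = {(a, b). a + b = m}"

lemma finite_splittings [simp]: "finite (splittings m)"
proof -
  let ?F = "{f. \<forall>x. (x \<in> Poly_Mapping.keys m \<longrightarrow> f x \<in> {..Max (Poly_Mapping.lookup m ` Poly_Mapping.keys m)}) \<and> (x \<notin> Poly_Mapping.keys m \<longrightarrow> f x = (0::nat))}"
  have fin: "finite ?F"
    by (rule finite_set_of_finite_funs) auto
  have "inj_on (\<lambda>(a, b). (Poly_Mapping.lookup a, Poly_Mapping.lookup b)) (splittings m)"
    by (auto simp: inj_on_def)
  moreover have "(\<lambda>(a, b). (Poly_Mapping.lookup a, Poly_Mapping.lookup b)) ` splittings m \<subseteq> ?F \<times> ?F"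
  proof (clarsimp simp: splittings_def lookup_add, intro conjI allI impI)
    fix a b :: "'a \<Rightarrow>\<^sub>0 nat" and x
    assume "x \<in> Poly_Mapping.keys (a + b)"
    then have "Poly_Mapping.lookup (a + b) x \<le> Max (Poly_Mapping.lookup (a + b) ` Poly_Mapping.keys (a + b))"
      by (intro Max_ge) auto
    then show "Poly_Mapping.lookup a x \<le> Max ((\<lambda>x. Poly_Mapping.lookup a x + Poly_Mapping.lookup b x) ` Poly_Mapping.keys (a + b))"
      "Poly_Mapping.lookup b x \<le> Max ((\<lambda>x. Poly_Mapping.lookup a x + Poly_Mapping.lookup b x) ` Poly_Mapping.keys (a + b))"
      by (simp_all add: lookup_add)
  qed (simp_all add: in_keys_iff lookup_add)
  ultimately show ?thesis
    using fin by (meson finite_SigmaI finite_imageD finite_subset)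
qed

instantiation mps :: (type, ring_1) ring_1
begin

definition "0 = Abs_mps (\<lambda>_. 0)"
definition "1 = Abs_mps (\<lambda>m. if m = 0 then 1 else 0)"
definition "f + g = Abs_mps (\<lambda>m. mps_coeff f m + mps_coeff g m)"
definition "f - g = Abs_mps (\<lambda>m. mps_coeff f m - mps_coeff g m)"
definition "- f = Abs_mps (\<lambda>m. - mps_coeff f m)"
definition "f * g = Abs_mps (\<lambda>m. \<Sum>(a, b) \<in> splittings m. mps_coeff f a * mps_coeff g b)"

instance
proof
  fix f g h :: "('a, 'b) mps"
  show "f * g * h = f * (g * h)"
  proof (rule mps_eqI)
    fix m
    let ?c = "\<lambda>(a, b, c). mps_coeff f a * (mps_coeff g b * mps_coeff h c)"
    have "mps_coeff (f * g * h) m =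
        (\<Sum>((x, c), (a, b)) \<in> (SIGMA p : splittings m. splittings (fst p)). ?c (a, b, c))"
      by (simp add: times_mps_def sum_distrib_right mult.assoc sum.Sigma split_def)
    also have "\<dots> = (\<Sum>((a, y), (b, c)) \<in> (SIGMA p : splittings m. splittings (snd p)). ?c (a, b, c))"
      by (rule sum.reindex_bij_witness[where
            i = "\<lambda>((a, y), (b, c)). ((a + b, c), (a, b))" and
            j = "\<lambda>((x, c), (a, b)). ((a, b + c), (b, c))"])
        (auto simp: splittings_def add.assoc)
    also have "\<dots> = mps_coeff (f * (g * h)) m"
      by (simp add: times_mps_def sum_distrib_left sum.Sigma split_def)
    finally show "mps_coeff (f * g * h) m = mps_coeff (f * (g * h)) m" .
  qed
  show "1 * f = f"
  proof (rule mps_eqI)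
    fix m
    have "mps_coeff (1 * f) m = (\<Sum>p \<in> splittings m. if p = (0, m) then mps_coeff f m else 0)"
      unfolding times_mps_def one_mps_def mps_coeff_Abs
      by (rule sum.cong) (auto simp: splittings_def split: if_splits)
    then show "mps_coeff (1 * f) m = mps_coeff f m"
      by (simp add: splittings_def sum.delta[OF finite_splittings[unfolded splittings_def]])
  qed
  show "f * 1 = f"
  proof (rule mps_eqI)
    fix m
    have "mps_coeff (f * 1) m = (\<Sum>p \<in> splittings m. if p = (m, 0) then mps_coeff f m else 0)"
      unfolding times_mps_def one_mps_def mps_coeff_Abs
      by (rule sum.cong) (auto simp: splittings_def split: if_splits)
    then show "mps_coeff (f * 1) m = mps_coeff f m"
      by (simp add: splittings_def sum.delta[OF finite_splittings[unfolded splittings_def]])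
  qed
  show "(f + g) * h = f * h + g * h" "f * (g + h) = f * g + f * h"
    by (rule mps_eqI; simp add: times_mps_def plus_mps_def split_def algebra_simps sum.distrib)+
  show "f + g + h = f + (g + h)" "f + g = g + f" "0 + f = f" "- f + f = 0" "f - g = f + - g"
    by (rule mps_eqI; simp add: plus_mps_def zero_mps_def uminus_mps_def minus_mps_def add_ac)+
  have "mps_coeff (0 :: ('a, 'b) mps) 0 \<noteq> mps_coeff 1 0"
    by (simp add: zero_mps_def one_mps_def)
  then show "(0 :: ('a, 'b) mps) \<noteq> 1"
    by metis
qed

end

text \<open>
  Infinite sum of a locally finite family of series. \<^const>\<open>Sum_any\<close> sums over the support; it
  yields 0 if the support is infinite, so this is meaningful only if every monomial
  occurs in finitely many members of the family. For the two uses below this is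
  \<open>quasi_inverse_locally_finite\<close> and \<open>growth_locally_finite\<close>.
\<close>

definition mps_Sum :: "('k \<Rightarrow> ('i, 'r::ring_1) mps) \<Rightarrow> ('i, 'r) mps" where
  "mps_Sum F = Abs_mps (\<lambda>m. Sum_any (\<lambda>k. mps_coeff (F k) m))"

definition mps_monom :: "'r::ring_1 \<Rightarrow> ('i \<Rightarrow>\<^sub>0 nat) \<Rightarrow> ('i, 'r) mps" where
  "mps_monom c m = Abs_mps (\<lambda>m'. if m' = m then c else 0)"

text \<open>The inclusion of the polynomial ring, as a monoid ring, into the ring of series.\<close>

definition mps_of_poly :: "(('i \<Rightarrow>\<^sub>0 nat) \<Rightarrow>\<^sub>0 'r::ring_1) \<Rightarrow> ('i, 'r) mps" where
  "mps_of_poly p = Abs_mps (Poly_Mapping.lookup p)"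

definition quasi_inverse :: "('i, 'r::ring_1) mps \<Rightarrow> ('i, 'r) mps" where
  "quasi_inverse f = mps_Sum (\<lambda>n. f ^ Suc n)"

inductive rational_series :: "('i, 'r::ring_1) mps \<Rightarrow> bool" where
  polynomial: "rational_series (mps_of_poly p)"
| add: "rational_series f \<Longrightarrow> rational_series g \<Longrightarrow> rational_series (f + g)"
| mult: "rational_series f \<Longrightarrow> rational_series g \<Longrightarrow> rational_series (f * g)"
| quasi_inverse: "rational_series f \<Longrightarrow> mps_coeff f 0 = 0 \<Longrightarrow> rational_series (quasi_inverse f)"

definition total_degree :: "('i \<Rightarrow>\<^sub>0 nat) \<Rightarrow> nat" where
  "total_degree m = Sum_any (Poly_Mapping.lookup m)"

lemma total_degree_add: "total_degree (a + b) = total_degree a + total_degree b"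
  by (simp add: total_degree_def lookup_add Sum_any.distrib finite_lookup)

lemma total_degree_single [simp]: "total_degree (Poly_Mapping.single x k) = k"
  by (simp add: total_degree_def lookup_single when_def)

lemma total_degree_zero [simp]: "total_degree 0 = 0"
  by (simp add: total_degree_def)

lemma total_degree_eq_0_iff: "total_degree m = 0 \<longleftrightarrow> m = 0"
proof
  assume "total_degree m = 0"
  then have "\<forall>x. Poly_Mapping.lookup m x = 0"
    by (simp add: total_degree_def Sum_any_eq_zero_iff fun_eq_iff)
  then show "m = 0"
    by (simp add: poly_mapping_eqI)
qed simp

lemma coeff_power_eq_0:
  assumes "mps_coeff f 0 = 0" and "total_degree m < n"
  shows "mps_coeff (f ^ n) m = 0"
  using assms(2)
proof (induction n arbitrary: m)
  case (Suc n)
  have "mps_coeff f a * mps_coeff (f ^ n) b = 0" if "a + b = m" for a b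
  proof (cases "a = 0")
    case False
    then have "total_degree a > 0"
      using total_degree_eq_0_iff by blast
    then have "total_degree b < n"
      using Suc.prems that total_degree_add[of a b] by simp
    then show ?thesis by (simp add: Suc.IH)
  qed (simp add: assms)
  then show ?case
    by (auto simp: times_mps_def splittings_def intro!: sum.neutral)
qed simp

lemma quasi_inverse_locally_finite:
  assumes "mps_coeff f 0 = 0"
  shows "finite {n. mps_coeff (f ^ Suc n) m \<noteq> 0}"
proof (rule finite_subset)
  show "{n. mps_coeff (f ^ Suc n) m \<noteq> 0} \<subseteq> {..total_degree m}"
  proof
    fix n
    assume "n \<in> {n. mps_coeff (f ^ Suc n) m \<noteq> 0}"
    then have "\<not> total_degree m < Suc n"
      using coeff_power_eq_0[OF assms] by blast
    then show "n \<in> {..total_degree m}" by simp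
  qed
qed simp


section \<open>Group presentations\<close>

text \<open>
  Groups are types of class \<^class>\<open>group_add\<close>, which does not assume commutativity. The product of
  the group is thus written \<open>+\<close>, its unit \<open>0\<close> and the inverse of \<open>x\<close> is \<open>- x\<close>. This makes
  \<open>'w \<Rightarrow>\<^sub>0 rat\<close>, with its convolution product, the rational group ring of \<open>'w\<close>.

  A group word is a list of signed letters; \<open>(x, False)\<close> stands for the formal inverse of \<open>x\<close>.
\<close>

type_synonym 'a gword = "('a \<times> bool) list"

definition gword_val :: "('a::group_add) gword \<Rightarrow> 'a" where
  "gword_val ws = sum_list (map (\<lambda>(x, b). if b then x else - x) ws)"

text \<open>
  Equality in the quotient of the free group on \<open>S\<close> by the normal closure of \<open>R\<close>.
\<close>

inductive pres_eq :: "'a set \<Rightarrow> 'a gword set \<Rightarrow> 'a gword \<Rightarrow> 'a gword \<Rightarrow> bool"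
  for S R where
  refl: "u \<in> lists (S \<times> UNIV) \<Longrightarrow> pres_eq S R u u"
| sym: "pres_eq S R u v \<Longrightarrow> pres_eq S R v u"
| trans: "pres_eq S R u v \<Longrightarrow> pres_eq S R v w \<Longrightarrow> pres_eq S R u w"
| cancel: "u \<in> lists (S \<times> UNIV) \<Longrightarrow> v \<in> lists (S \<times> UNIV) \<Longrightarrow> x \<in> S \<Longrightarrow>
    pres_eq S R (u @ [(x, b), (x, \<not> b)] @ v) (u @ v)"
| relator: "u \<in> lists (S \<times> UNIV) \<Longrightarrow> v \<in> lists (S \<times> UNIV) \<Longrightarrow> r \<in> R \<Longrightarrow>
    pres_eq S R (u @ r @ v) (u @ v)"

text \<open>The natural map from that quotient to the whole group is bijective.\<close>

definition presented_by :: "('a::group_add) set \<Rightarrow> 'a gword set \<Rightarrow> bool" where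
  "presented_by S R \<longleftrightarrow>
     gword_val ` lists (S \<times> UNIV) = UNIV \<and>
     (\<forall>u \<in> lists (S \<times> UNIV). \<forall>v \<in> lists (S \<times> UNIV).
        gword_val u = gword_val v \<longleftrightarrow> pres_eq S R u v)"


section \<open>Coxeter systems and their growth series\<close>

definition coxeter_matrix :: "'a set \<Rightarrow> ('a \<Rightarrow> 'a \<Rightarrow> enat) \<Rightarrow> bool" where
  "coxeter_matrix S m \<longleftrightarrow>
     (\<forall>s \<in> S. \<forall>s' \<in> S. m s s' = m s' s \<and> 1 \<le> m s s' \<and> (m s s' = 1 \<longleftrightarrow> s = s'))"

definition coxeter_relators :: "'a set \<Rightarrow> ('a \<Rightarrow> 'a \<Rightarrow> enat) \<Rightarrow> 'a gword set" where
  "coxeter_relators S m =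
     {concat (replicate k [(s, True), (s', True)]) | s s' k. s \<in> S \<and> s' \<in> S \<and> m s s' = enat k}"

definition coxeter_system :: "('w::group_add) set \<Rightarrow> ('w \<Rightarrow> 'w \<Rightarrow> enat) \<Rightarrow> bool" where
  "coxeter_system S m \<longleftrightarrow> coxeter_matrix S m \<and> presented_by S (coxeter_relators S m)"

definition group_conj :: "'w::group_add \<Rightarrow> 'w \<Rightarrow> bool" where
  "group_conj x y \<longleftrightarrow> (\<exists>g. y = g + x + (- g))"

definition reduced_expression :: "('w::group_add) set \<Rightarrow> 'w \<Rightarrow> 'w list \<Rightarrow> bool" where
  "reduced_expression S w ws \<longleftrightarrow>
     ws \<in> lists S \<and> sum_list ws = w \<and>
     (\<forall>vs \<in> lists S. sum_list vs = w \<longrightarrow> length ws \<le> length vs)"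

text \<open>The exponent vector of the monomial \<open>t\<^sup>w\<close>, computed from some reduced expression of \<open>w\<close>.\<close>

definition t_exp :: "('w::group_add) set \<Rightarrow> ('w \<Rightarrow> 'i) \<Rightarrow> 'w \<Rightarrow> ('i \<Rightarrow>\<^sub>0 nat)" where
  "t_exp S i w =
     sum_list (map (\<lambda>s. Poly_Mapping.single (i s) 1) (SOME ws. reduced_expression S w ws))"

definition growth_series :: "('w::group_add) set \<Rightarrow> ('w \<Rightarrow> 'i) \<Rightarrow> ('i, rat) mps" where
  "growth_series S i = mps_Sum (\<lambda>w. mps_monom 1 (t_exp S i w))"

definition complete_growth_series ::
    "('w::group_add) set \<Rightarrow> ('w \<Rightarrow> 'i) \<Rightarrow> ('i, 'w \<Rightarrow>\<^sub>0 rat) mps" where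
  "complete_growth_series S i = mps_Sum (\<lambda>w. mps_monom (Poly_Mapping.single w 1) (t_exp S i w))"

lemma coxeter_generator_involution:
  assumes "coxeter_system S m" and "s \<in> S"
  shows "s + s = 0"
proof -
  let ?r = "[(s, True), (s, True)]"
  have "?r \<in> coxeter_relators S m"
  proof -
    have "m s s = enat 1"
      using assms by (simp add: coxeter_system_def coxeter_matrix_def one_enat_def)
    moreover have "?r = concat (replicate 1 [(s, True), (s, True)])"
      by simp
    ultimately show ?thesis
      using assms(2) unfolding coxeter_relators_def by blast
  qed
  then have "pres_eq S (coxeter_relators S m) ([] @ ?r @ []) ([] @ [])"
    by (intro pres_eq.relator) auto
  then have "pres_eq S (coxeter_relators S m) ?r []" by simp
  moreover have "?r \<in> lists (S \<times> UNIV)" "[] \<in> lists (S \<times> UNIV)"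
    using assms(2) by simp_all
  ultimately have "gword_val ?r = gword_val []"
    using assms(1) unfolding coxeter_system_def presented_by_def by blast
  then show ?thesis by (simp add: gword_val_def)
qed

lemma ex_reduced_expression:
  assumes "coxeter_system S m"
  shows "\<exists>ws. reduced_expression S w ws"
proof -
  have "w \<in> gword_val ` lists (S \<times> UNIV)"
    using assms by (simp add: coxeter_system_def presented_by_def)
  then obtain u where u: "u \<in> lists (S \<times> UNIV)" "gword_val u = w"
    by blast
  have "- s = s" if "s \<in> S" for s
    using coxeter_generator_involution[OF assms that] by (simp add: minus_unique)
  then have "gword_val u = sum_list (map fst u) \<and> map fst u \<in> lists S"
    using u(1) by (induction u) (auto simp: gword_val_def)
  then have "\<exists>ws. ws \<in> lists S \<and> sum_list ws = w"
    using u(2) by metis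
  then show ?thesis
    using ex_has_least_nat[of "\<lambda>ws. ws \<in> lists S \<and> sum_list ws = w" _ length]
    unfolding reduced_expression_def by metis
qed

lemma growth_locally_finite:
  assumes "coxeter_system S m" and "finite S"
  shows "finite {w. t_exp S i w = e}"
proof -
  define red where "red w = (SOME ws. reduced_expression S w ws)" for w
  have red: "reduced_expression S w (red w)" for w
    unfolding red_def using ex_reduced_expression[OF assms(1)] by (rule someI_ex)
  have deg: "total_degree (t_exp S i w) = length (red w)" for w
  proof -
    have "total_degree (sum_list (map (\<lambda>s. Poly_Mapping.single (i s) 1) ws)) = length ws" for ws
      by (induction ws) (simp_all add: total_degree_add)
    then show ?thesis by (simp add: t_exp_def red_def)
  qed
  have "inj red"
    using red unfolding reduced_expression_def by (metis injI)
  moreover have "red ` {w. t_exp S i w = e} \<subseteq> {ws. set ws \<subseteq> S \<and> length ws = total_degree e}"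
    using red deg unfolding reduced_expression_def by auto
  ultimately show ?thesis
    using finite_lists_length_eq[OF assms(2)] by (meson finite_imageD finite_subset inj_on_subset subset_UNIV)
qed

end

theory Submission
  imports Defs
begin

text \<open>
  For \<open>T \<subseteq> S\<close> let \<open>f\<^sub>T\<close> be the growth series of the parabolic subgroup \<open>W\<^sub>T\<close>, with weights in an
  arbitrary ring. Every element of \<open>W\<^sub>U\<close> is uniquely a product, with lengths adding up, of a minimal
  representative of its coset of \<open>W\<^sub>T\<close> and an element of \<open>W\<^sub>T\<close>, so the series of the representatives
  is \<open>f\<^sub>U f\<^sub>T\<inverse>\<close>. An element \<open>w\<close> is such a representative iff \<open>T\<close> avoids the right descents of \<open>w\<close>.
  Unless some \<open>w \<in> W\<^sub>U\<close> has all of \<open>U\<close> as descents, in which case \<open>W\<^sub>U\<close> is finite, inclusion-exclusion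
  therefore gives \<open>\<Sum>\<^sub>T (-1)\<^bsup>|T|\<^esup> f\<^sub>U f\<^sub>T\<inverse> = 0\<close>, the sum being over \<open>T \<subseteq> U\<close>. This expresses \<open>f\<^sub>U\<inverse>\<close> by
  the \<open>f\<^sub>T\<inverse>\<close> of proper subsets \<open>T\<close>, and rationality follows by induction on \<open>U\<close>.

  The Coxeter combinatorics comes from the inversion set of \<open>w\<close>: the reflections occurring an odd
  number of times among the \<open>s\<^sub>1 \<dots> s\<^sub>j \<dots> s\<^sub>1\<close> of a word for \<open>w\<close>. It depends on \<open>w\<close> only, because a
  relator contributes each reflection an even number of times.
\<close>

section \<open>Rational series\<close>

lemma mps_coeff_simps [simp]:
  "mps_coeff 0 e = 0"
  "mps_coeff 1 e = (if e = 0 then 1 else 0)"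
  "mps_coeff (f + g) e = mps_coeff f e + mps_coeff g e"
  "mps_coeff (f - g) e = mps_coeff f e - mps_coeff g e"
  "mps_coeff (- f) e = - mps_coeff f e"
  by (simp_all add: zero_mps_def one_mps_def plus_mps_def minus_mps_def uminus_mps_def)

lemma mps_coeff_times:
  "mps_coeff (f * g) e = (\<Sum>(a, b) \<in> splittings e. mps_coeff f a * mps_coeff g b)"
  by (simp add: times_mps_def)

lemma mps_coeff_sum: "mps_coeff (sum F A) e = (\<Sum>k\<in>A. mps_coeff (F k) e)"
  by (induction A rule: infinite_finite_induct) auto

lemma splittings_zero: "splittings 0 = {(0, 0)}"
  by (force simp: splittings_def total_degree_add simp flip: total_degree_eq_0_iff)

lemma mps_coeff_times_0: "mps_coeff (f * g) 0 = mps_coeff f 0 * mps_coeff g 0"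
  by (simp add: mps_coeff_times splittings_zero)

lemma mps_coeff_sign_times: "mps_coeff ((- 1) ^ k * f) e = (- 1) ^ k * mps_coeff f e"
  by (induction k) (simp_all add: mult.assoc)

text \<open>Powers above the total degree vanish at \<open>e\<close>, so the infinite sum truncates.
  Keeping \<open>N\<close> free lets one truncation serve all monomials of bounded degree.\<close>

lemma mps_coeff_quasi_inverse:
  assumes "mps_coeff f 0 = 0" "total_degree e \<le> N"
  shows "mps_coeff (quasi_inverse f) e = (\<Sum>n<N. mps_coeff (f ^ Suc n) e)"
  unfolding quasi_inverse_def mps_Sum_def mps_coeff_Abs
proof (rule Sum_any.expand_superset)
  show "{n. mps_coeff (f ^ Suc n) e \<noteq> 0} \<subseteq> {..<N}"
  proof
    fix n assume "n \<in> {n. mps_coeff (f ^ Suc n) e \<noteq> 0}"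
    then have "\<not> total_degree e < Suc n"
      using coeff_power_eq_0[OF assms(1)] by blast
    then show "n \<in> {..<N}"
      using assms(2) by simp
  qed
qed simp

lemma quasi_inverse_unfold:
  fixes f :: "('i, 'r::ring_1) mps"
  assumes "mps_coeff f 0 = 0"
  shows "f + f * quasi_inverse f = quasi_inverse f"
proof (rule mps_eqI)
  fix e :: "'i \<Rightarrow>\<^sub>0 nat"
  \<comment> \<open>\<open>P\<close> agrees with the quasi-inverse in every degree that the
    coefficient of \<open>f * quasi_inverse f\<close> at \<open>e\<close> can see.\<close>
  define P where "P = (\<Sum>n<total_degree e. f ^ Suc n)"
  have P: "mps_coeff (quasi_inverse f) a = mps_coeff P a" if "total_degree a \<le> total_degree e" for a
    using mps_coeff_quasi_inverse[OF assms that] by (simp add: P_def mps_coeff_sum)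
  have "f + f * P = (\<Sum>n<Suc (total_degree e). f ^ Suc n)"
    unfolding P_def by (subst sum.lessThan_Suc_shift) (simp add: sum_distrib_left)
  \<comment> \<open>One summand more than the degree requires, to match the shape of
    \<open>f + f * P\<close>.\<close>
  moreover have "mps_coeff (quasi_inverse f) e = mps_coeff (\<Sum>n<Suc (total_degree e). f ^ Suc n) e"
    using mps_coeff_quasi_inverse[OF assms, of e "Suc (total_degree e)"] by (simp add: mps_coeff_sum)
  moreover have "mps_coeff (f * quasi_inverse f) e = mps_coeff (f * P) e"
    unfolding mps_coeff_times
    by (auto intro!: sum.cong simp: splittings_def P total_degree_add)
  ultimately show "mps_coeff (f + f * quasi_inverse f) e = mps_coeff (quasi_inverse f) e"
    by (metis mps_coeff_simps(3))
qed

lemma rational_finite_support: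
  assumes "finite {e. mps_coeff f e \<noteq> 0}"
  shows "rational_series f"
proof -
  have "f = mps_of_poly (Abs_poly_mapping (mps_coeff f))"
    by (rule mps_eqI) (simp add: mps_of_poly_def assms)
  then show ?thesis
    by (metis rational_series.polynomial)
qed

lemma rational_const: "rational_series 0" "rational_series 1" "rational_series (- 1)"
  by (rule rational_finite_support; simp)+

lemma rational_uminus: "rational_series f \<Longrightarrow> rational_series (- f)"
  using rational_series.mult[OF rational_const(3)] by fastforce

lemma rational_diff: "rational_series f \<Longrightarrow> rational_series g \<Longrightarrow> rational_series (f - g)"
  using rational_series.add[OF _ rational_uminus] by fastforce

lemma rational_sign: "rational_series ((- 1) ^ k)"
  by (induction k) (auto intro: rational_const rational_uminus)

lemma rational_sum: "(\<And>k. k \<in> A \<Longrightarrow> rational_series (F k)) \<Longrightarrow> rational_series (sum F A)"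
  by (induction A rule: infinite_finite_induct) (auto intro: rational_const rational_series.add)

text \<open>Geometric series: with \<open>h = 1 - f\<close>, the inverse is
  \<open>1 + quasi_inverse h\<close>. Coefficients need not commute; a right inverse is what the
  later cancellations use.\<close>

lemma rational_inverse:
  assumes "rational_series f" "mps_coeff f 0 = 1"
  obtains g where "rational_series g" "f * g = 1"
proof
  have 0: "mps_coeff (1 - f) 0 = 0"
    using assms(2) by simp
  show "rational_series (1 + quasi_inverse (1 - f))"
    using assms(1) 0
    by (intro rational_series.add rational_series.quasi_inverse rational_diff rational_const)
  show "f * (1 + quasi_inverse (1 - f)) = 1"
    using quasi_inverse_unfold[OF 0] by (simp add: algebra_simps)
qed

text \<open>A nonempty finite set has as many even as odd subsets.\<close>

lemma sum_sign_Pow: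
  assumes "finite A" "A \<noteq> {}"
  shows "(\<Sum>T\<in>Pow A. (- 1) ^ card T) = (0 :: 'r::ring_1)"
  using assms card_subsupersets_even_odd[of A "{}"]
  by (intro sum_alternating_cancels) (auto simp: Pow_def)

section \<open>Reflections of words\<close>

definition conjugate :: "'w::group_add \<Rightarrow> 'w \<Rightarrow> 'w" where
  "conjugate g x = g + x - g"

lemma conjugate_add: "conjugate (g + h) x = conjugate g (conjugate h x)"
  by (simp add: conjugate_def diff_add_eq_diff_diff_swap add.assoc add_diff_eq)

lemma conjugate_zero [simp]: "conjugate 0 x = x"
  by (simp add: conjugate_def)

lemma conjugate_minus_cancel [simp]: "conjugate (- g) (conjugate g x) = x" "conjugate g (conjugate (- g) x) = x"
  by (simp_all flip: conjugate_add)

lemma conjugate_eq_iff [simp]: "conjugate g x = conjugate g y \<longleftrightarrow> x = y"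
  by (metis conjugate_minus_cancel(1))

lemma conjugate_eq_swap: "conjugate g x = y \<longleftrightarrow> x = conjugate (- g) y"
  by auto

lemma inj_conjugate: "inj (conjugate g)"
  by (simp add: inj_def)

lemma conjugate_plus [simp]: "conjugate g x + g = g + x"
  by (simp add: conjugate_def)

lemma group_conj_iff_conjugate: "group_conj x y \<longleftrightarrow> (\<exists>g. y = conjugate g x)"
  by (simp add: group_conj_def conjugate_def)

lemma group_conj_refl: "group_conj x x"
  unfolding group_conj_iff_conjugate by (metis conjugate_zero)

lemma group_conj_conjugate: "group_conj x (conjugate g y) \<longleftrightarrow> group_conj x y"
  unfolding group_conj_iff_conjugate by (metis conjugate_add conjugate_minus_cancel(1))

text \<open>The \<open>j\<close>-th entry is the \<open>j\<close>-th letter conjugated by the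
  product of the letters before it. For involutive letters, adding it on the left of the product
  deletes that letter.\<close>

fun refls :: "'w::group_add list \<Rightarrow> 'w list" where
  "refls [] = []"
| "refls (x # ws) = x # map (conjugate x) (refls ws)"

lemma length_refls [simp]: "length (refls ws) = length ws"
  by (induction ws) auto

lemma refls_append: "refls (us @ vs) = refls us @ map (conjugate (sum_list us)) (refls vs)"
  by (induction us) (auto simp: conjugate_add)

definition odd_refls :: "'w::group_add list \<Rightarrow> 'w set" where
  "odd_refls ws = {r. odd (count_list (refls ws) r)}"

lemma odd_refls_subset: "odd_refls ws \<subseteq> set (refls ws)"
  by (auto simp: odd_refls_def) (metis count_notin dvd_0_right)

lemma odd_refls_distinct:
  fixes ws :: "'w::group_add list"
  shows "distinct (refls ws) \<Longrightarrow> odd_refls ws = set (refls ws)"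
proof -
  have "distinct xs \<Longrightarrow> count_list xs r = (if r \<in> set xs then 1 else 0)" for xs :: "'w list" and r
    by (induction xs) auto
  then show "distinct (refls ws) \<Longrightarrow> odd_refls ws = set (refls ws)"
    by (auto simp: odd_refls_def split: if_splits)
qed

lemma count_list_map_conjugate: "count_list (map (conjugate g) ws) r = count_list ws (conjugate (- g) r)"
  by (induction ws) (auto simp: conjugate_eq_swap)

text \<open>Parities add, so this is a symmetric difference, with the second set conjugated by the
  first product: a cocycle rule.\<close>

lemma odd_refls_append:
  "r \<in> odd_refls (us @ vs) \<longleftrightarrow> (r \<in> odd_refls us) \<noteq> (conjugate (- sum_list us) r \<in> odd_refls vs)"
  by (simp add: odd_refls_def refls_append count_list_map_conjugate)

text \<open>Inverses are not adjoined: for involutive generators this monoid is already the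
  subgroup, see \<open>generated_uminus\<close>.\<close>

definition generated :: "'w::group_add set \<Rightarrow> 'w set" where
  "generated T = sum_list ` lists T"

lemma generatedI: "ws \<in> lists T \<Longrightarrow> sum_list ws \<in> generated T"
  by (simp add: generated_def)

lemma generatedE:
  assumes "w \<in> generated T"
  obtains ws where "ws \<in> lists T" "sum_list ws = w"
  using assms by (auto simp: generated_def)

lemma zero_in_generated [simp]: "0 \<in> generated T"
  using generatedI[of "[]"] by simp

lemma generator_in_generated: "x \<in> T \<Longrightarrow> x \<in> generated T"
  using generatedI[of "[x]"] by simp

lemma generated_add: "u \<in> generated T \<Longrightarrow> v \<in> generated T \<Longrightarrow> u + v \<in> generated T"
  by (metis append_in_lists_conv generatedE generatedI sum_list_append)

lemma generated_mono: "T \<subseteq> U \<Longrightarrow> generated T \<subseteq> generated U"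
  unfolding generated_def by (intro image_mono lists_mono)

text \<open>The iterates of \<open>(+) (s + t)\<close> are powers of the rotation \<open>st\<close>,
  so the entries are \<open>(st)^j s\<close>. Prefixing \<open>[s, t]\<close> conjugates by
  \<open>s + t\<close>, which raises \<open>j\<close> by two.\<close>

lemma refls_dihedral:
  fixes s t :: "'w::group_add"
  assumes "s + s = 0" "t + t = 0"
  shows "refls (concat (replicate k [s, t])) = map (\<lambda>j. ((+) (s + t) ^^ j) s) [0..<2 * k]"
proof (induction k)
  case (Suc k)
  have inv: "- s = s" "- t = t"
    using assms by (simp_all add: minus_unique)
  have st: "s - (s + t) = s + t + s"
    using inv by (metis add.assoc diff_conv_add_uminus minus_add)
  have "conjugate s (conjugate t (((+) (s + t) ^^ j) s)) = ((+) (s + t) ^^ Suc (Suc j)) s" for j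
  proof (induction j)
    case 0
    have "conjugate s (conjugate t s) = (s + t) + (s - (s + t))"
      by (simp add: conjugate_def add_diff_eq diff_add_eq_diff_diff_swap add.assoc)
    then show ?case
      by (simp add: st)
  next
    case (Suc j)
    have "conjugate (s + t) (s + t + y) = s + t + conjugate (s + t) y" for y
      by (simp add: conjugate_def add.assoc add_diff_eq)
    then show ?case
      using Suc by (simp flip: conjugate_add)
  qed
  moreover have shift: "[2..<2 * Suc k] = map (\<lambda>j. Suc (Suc j)) [0..<2 * k]"
    by (rule nth_equalityI) (auto simp del: upt_Suc)
  ultimately have "map (conjugate s) (map (conjugate t) (refls (concat (replicate k [s, t])))) =
      map (\<lambda>j. ((+) (s + t) ^^ j) s) [2..<2 * Suc k]"
    unfolding Suc.IH shift by simp
  moreover have "conjugate s t = ((+) (s + t) ^^ 1) s"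
    using inv by (simp add: conjugate_def) (metis diff_conv_add_uminus)
  moreover have "[0..<2 * Suc k] = 0 # 1 # [2..<2 * Suc k]"
    by (simp add: upt_conv_Cons eval_nat_numeral)
  ultimately show ?case
    by simp
qed simp

lemma funpow_plus: "((+) x ^^ k) y = sum_list (replicate k x) + (y::'w::monoid_add)"
  by (induction k) (auto simp: add.assoc)

text \<open>If \<open>(st)^k\<close> is trivial, the \<open>2 * k\<close> reflections repeat with
  period \<open>k\<close>, so each occurs an even number of times.\<close>

lemma odd_refls_dihedral:
  fixes s t :: "'w::group_add"
  assumes "s + s = 0" "t + t = 0" "sum_list (concat (replicate k [s, t])) = 0"
  shows "odd_refls (concat (replicate k [s, t])) = {}"
proof -
  have "sum_list (concat (replicate k [s, t])) = sum_list (replicate k (s + t))"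
    by (induction k) (auto simp: add.assoc)
  then have "((+) (s + t) ^^ (j + k)) s = ((+) (s + t) ^^ j) s" for j
    using assms(3) by (simp add: funpow_add) (simp add: funpow_plus)
  then have "map (\<lambda>j. ((+) (s + t) ^^ j) s) [k..<k + k] = map (\<lambda>j. ((+) (s + t) ^^ j) s) [0..<k]"
    by (intro nth_equalityI) (auto simp: add.commute)
  moreover have "[0..<2 * k] = [0..<k] @ [k..<k + k]"
    using upt_add_eq_append[of 0 k k] by (simp add: mult_2)
  ultimately show ?thesis
    unfolding odd_refls_def refls_dihedral[OF assms(1,2)] by simp
qed

section \<open>Inversions and cosets in Coxeter groups\<close>

locale coxeter =
  fixes S :: "'w::group_add set" and m :: "'w \<Rightarrow> 'w \<Rightarrow> enat"
  assumes coxeter_system: "coxeter_system S m"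
begin

section \<open>Invariance of the inversion set\<close>

lemma involution: "s \<in> S \<Longrightarrow> s + s = 0"
  by (rule coxeter_generator_involution[OF coxeter_system])

lemma minus_generator: "s \<in> S \<Longrightarrow> - s = s"
  by (simp add: involution minus_unique)

lemma gword_val_eq: "u \<in> lists (S \<times> UNIV) \<Longrightarrow> gword_val u = sum_list (map fst u)"
  by (induction u) (auto simp: gword_val_def minus_generator)

lemma pres_eq_iff:
  "u \<in> lists (S \<times> UNIV) \<Longrightarrow> v \<in> lists (S \<times> UNIV) \<Longrightarrow>
    pres_eq S (coxeter_relators S m) u v \<longleftrightarrow> sum_list (map fst u) = sum_list (map fst v)"
  using coxeter_system unfolding coxeter_system_def presented_by_def
  by (metis gword_val_eq)

text \<open>A relator contributes no odd reflection, and having sum 0 it does not conjugate those of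
  the letters after it.\<close>

lemma relator:
  assumes "r \<in> coxeter_relators S m"
  shows "sum_list (map fst r) = 0" "odd_refls (map fst r) = {}"
proof -
  obtain s t k where st: "s \<in> S" "t \<in> S" and r: "r = concat (replicate k [(s, True), (t, True)])"
    using assms by (auto simp: coxeter_relators_def)
  have fst_r: "map fst r = concat (replicate k [s, t])"
    by (simp add: r map_concat)
  have "r \<in> lists (S \<times> UNIV)"
    using st by (auto simp: r split: if_splits)
  moreover have "pres_eq S (coxeter_relators S m) r []"
    using pres_eq.relator[OF _ _ assms, of "[]" S "[]"] by simp
  ultimately show 0: "sum_list (map fst r) = 0"
    by (subst (asm) pres_eq_iff) auto
  show "odd_refls (map fst r) = {}"
    using odd_refls_dihedral[of s t k] st involution 0 unfolding fst_r by blast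
qed

text \<open>Generators are involutions, so signs can be forgotten and a cancelling pair becomes
  \<open>[x, x]\<close>. Both kinds of rewriting remove a factor with sum 0 and no odd
  reflections.\<close>

lemma pres_eq_odd_refls:
  "pres_eq S (coxeter_relators S m) u v \<Longrightarrow> odd_refls (map fst u) = odd_refls (map fst v)"
proof (induction rule: pres_eq.induct)
  case (cancel u v x b)
  then have "sum_list [x, x] = 0" "odd_refls [x, x] = {}"
    using involution minus_generator by (auto simp: odd_refls_def conjugate_def)
  then show ?case
    using odd_refls_append[of _ "[x, x]" "map fst v"] by (auto simp: odd_refls_append)
next
  case (relator u v r)
  then show ?case
    using coxeter.relator[OF coxeter_axioms relator(3)] by (auto simp: odd_refls_append)
qed auto

text \<open>Here the presentation enters: words with equal value are linked by cancellations and
  relators, each of which preserves \<open>odd_refls\<close>.\<close>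

lemma odd_refls_cong:
  assumes "us \<in> lists S" "vs \<in> lists S" "sum_list us = sum_list vs"
  shows "odd_refls us = odd_refls vs"
proof -
  define l where "l = map (\<lambda>x::'w. (x, True))"
  have "l us \<in> lists (S \<times> UNIV)" "l vs \<in> lists (S \<times> UNIV)" "map fst (l us) = us" "map fst (l vs) = vs"
    using assms(1,2) by (auto simp: l_def o_def)
  then show ?thesis
    using pres_eq_odd_refls pres_eq_iff assms(3) by metis
qed

lemma ex_word: "\<exists>ws. ws \<in> lists S \<and> sum_list ws = w"
  using ex_reduced_expression[OF coxeter_system] unfolding reduced_expression_def by blast

lemma generated_UNIV: "generated S = UNIV"
  using ex_word by (metis UNIV_eq_I generatedI)

text \<open>By \<open>odd_refls_cong\<close> any word may be chosen, reduced or not. Left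
  multiplication by an inversion shortens \<open>w\<close>, see
  \<open>len_inversion_less\<close>.\<close>

definition inversions :: "'w \<Rightarrow> 'w set" where
  "inversions w = odd_refls (SOME ws. ws \<in> lists S \<and> sum_list ws = w)"

text \<open>This is the usual word length, by \<open>len_sum_list_le\<close> and
  \<open>ex_short_word\<close>.\<close>

definition len :: "'w \<Rightarrow> nat" where
  "len w = card (inversions w)"

lemma inversions_sum_list: "ws \<in> lists S \<Longrightarrow> inversions (sum_list ws) = odd_refls ws"
  unfolding inversions_def
  by (rule odd_refls_cong) (use someI_ex[OF ex_word] in auto)

lemma inversions_zero [simp]: "inversions 0 = {}"
  using inversions_sum_list[of "[]"] by (simp add: odd_refls_def)

lemma inversions_generator: "s \<in> S \<Longrightarrow> inversions s = {s}"
  using inversions_sum_list[of "[s]"] by (auto simp: odd_refls_def)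

lemma inversions_add:
  "r \<in> inversions (u + v) \<longleftrightarrow> (r \<in> inversions u) \<noteq> (conjugate (- u) r \<in> inversions v)"
proof -
  obtain us vs where "us \<in> lists S" "sum_list us = u" "vs \<in> lists S" "sum_list vs = v"
    using ex_word by metis
  then show ?thesis
    using odd_refls_append[of r us vs] inversions_sum_list[of "us @ vs"] inversions_sum_list by auto
qed

lemma finite_inversions [simp]: "finite (inversions w)"
  using ex_word[of w] inversions_sum_list odd_refls_subset finite_subset by (metis List.finite_set)

section \<open>Word length and the deletion condition\<close>

lemma len_sum_list_le: "ws \<in> lists S \<Longrightarrow> len (sum_list ws) \<le> length ws"
  unfolding len_def using inversions_sum_list[of ws] odd_refls_subset[of ws]
  by (metis List.finite_set card_length card_mono dual_order.trans length_refls)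

text \<open>The word \<open>vs\<close> omits the letter that \<open>r\<close> comes from. Staying
  inside \<open>T\<close> is what later compares lengths in a parabolic subgroup with those in the
  whole group.\<close>

lemma delete_letter:
  assumes "T \<subseteq> S" "ws \<in> lists T" "r \<in> set (refls ws)"
  shows "\<exists>vs \<in> lists T. length vs < length ws \<and> sum_list vs = r + sum_list ws"
  using assms(2,3)
proof (induction ws arbitrary: r)
  case (Cons x ws)
  then have x: "x \<in> T" "x + x = 0"
    using assms(1) involution by auto
  show ?case
  proof (cases "r = x")
    case True
    then show ?thesis
      using Cons.hyps x by (intro bexI[of _ ws]) (simp_all flip: add.assoc)
  next
    case False
    then obtain r' where r': "r = conjugate x r'" "r' \<in> set (refls ws)"
      using Cons.prems by auto
    then obtain vs where "vs \<in> lists T" "length vs < length ws" "sum_list vs = r' + sum_list ws"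
      using Cons.IH[of r'] by blast
    then show ?thesis
      using x r' by (intro bexI[of _ "x # vs"]) (auto simp flip: add.assoc)
  qed
qed simp

text \<open>Deletion condition: the two letters responsible for a repeated reflection can both be
  dropped.\<close>

lemma shorten_word:
  assumes "T \<subseteq> S" "ws \<in> lists T" "\<not> distinct (refls ws)"
  shows "\<exists>vs \<in> lists T. length vs < length ws \<and> sum_list vs = sum_list ws"
  using assms(2,3)
proof (induction ws)
  case (Cons x ws)
  then have x: "x \<in> T" "x + x = 0" "x \<in> S"
    using assms(1) involution by auto
  have ws: "ws \<in> lists T"
    using Cons.hyps by simp
  show ?case
  proof (cases "distinct (refls ws)")
    case True
    \<comment> \<open>Only the head can be repeated. Since \<open>conjugate x\<close> fixes
      \<open>x\<close>, it is a reflection of the tail itself, and deleting the letter behind it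
      absorbs the head.\<close>
    then have "x \<in> conjugate x ` set (refls ws)"
      using Cons.prems by (auto simp: distinct_map inj_on_def)
    moreover have "conjugate x x = x"
      by (simp add: conjugate_def)
    ultimately have "x \<in> set (refls ws)"
      by (metis (no_types, lifting) conjugate_eq_iff imageE)
    then obtain vs where "vs \<in> lists T" "length vs < length ws" "sum_list vs = x + sum_list ws"
      using delete_letter[OF assms(1) ws] by blast
    then show ?thesis
      by (intro bexI[of _ vs]) auto
  next
    case False
    then obtain vs where "vs \<in> lists T" "length vs < length ws" "sum_list vs = sum_list ws"
      using Cons.IH ws by auto
    then show ?thesis
      using x by (intro bexI[of _ "x # vs"]) auto
  qed
qed simp

text \<open>A shortest word over \<open>T\<close> has distinct reflections, which are then exactly
  the inversions. Hence length within the parabolic subgroup is length in the whole group.\<close>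

lemma ex_short_word:
  assumes "T \<subseteq> S" "w \<in> generated T"
  shows "\<exists>ws \<in> lists T. sum_list ws = w \<and> length ws = len w \<and> distinct (refls ws)"
proof -
  obtain ws where ws: "ws \<in> lists T" "sum_list ws = w"
    and min: "\<And>vs. vs \<in> lists T \<Longrightarrow> sum_list vs = w \<Longrightarrow> length ws \<le> length vs"
    using assms(2) ex_has_least_nat[of "\<lambda>ws. ws \<in> lists T \<and> sum_list ws = w" _ length]
    by (metis generatedE)
  have d: "distinct (refls ws)"
    using shorten_word[OF assms(1) ws(1)] ws(2) min by fastforce
  moreover have "ws \<in> lists S"
    using ws(1) assms(1) by auto
  ultimately have "inversions w = set (refls ws)"
    using inversions_sum_list odd_refls_distinct ws(2) by metis
  then show ?thesis
    using ws d unfolding len_def by (metis distinct_card length_refls)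
qed

lemma reduced_wordE:
  obtains ws where "ws \<in> lists S" "sum_list ws = w" "length ws = len w"
  using ex_short_word[of S w] by (auto simp: generated_UNIV)

lemma len_add_le: "len (u + v) \<le> len u + len v"
proof -
  obtain us where "us \<in> lists S" "sum_list us = u" "length us = len u"
    by (rule reduced_wordE)
  moreover obtain vs where "vs \<in> lists S" "sum_list vs = v" "length vs = len v"
    by (rule reduced_wordE)
  ultimately show ?thesis
    using len_sum_list_le[of "us @ vs"] by simp
qed

lemma len_zero [simp]: "len 0 = 0"
  by (simp add: len_def)

lemma len_eq_0_iff [simp]: "len w = 0 \<longleftrightarrow> w = 0"
proof
  assume "len w = 0"
  then obtain ws where "sum_list ws = w" "length ws = 0"
    by (metis reduced_wordE)
  then show "w = 0" by simp
qed simp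

text \<open>An inversion appears among the reflections of a reduced word, where it deletes a
  letter.\<close>

lemma len_inversion_less:
  assumes "r \<in> inversions u"
  shows "len (r + u) < len u"
proof -
  obtain us where us: "us \<in> lists S" "sum_list us = u" "length us = len u"
    by (rule reduced_wordE)
  then have "r \<in> set (refls us)"
    using assms inversions_sum_list[of us] odd_refls_subset[of us] by blast
  then obtain vs where "vs \<in> lists S" "length vs < length us" "sum_list vs = r + sum_list us"
    using delete_letter[of S us r] us(1) by blast
  then show ?thesis
    using us len_sum_list_le[of vs] by simp
qed

lemma generated_uminus:
  assumes "T \<subseteq> S" "w \<in> generated T"
  shows "- w \<in> generated T"
proof -
  obtain ws where "ws \<in> lists T" "sum_list ws = w"
    using assms(2) by (rule generatedE)
  moreover have "ws \<in> lists T \<Longrightarrow> - sum_list ws \<in> generated T" for ws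
  proof (induction ws)
    case (Cons x ws)
    then have "- x \<in> generated T"
      using assms(1) minus_generator[of x] generator_in_generated[of x T] by auto
    then show ?case
      using Cons by (simp add: minus_add generated_add del: add_uminus_conv_diff)
  qed simp
  ultimately show ?thesis by auto
qed

lemma inversions_generated:
  assumes "T \<subseteq> S" "w \<in> generated T"
  shows "inversions w \<subseteq> generated T"
proof -
  have "set (refls ws) \<subseteq> generated T" if "ws \<in> lists T" for ws
    using that
  proof (induction ws)
    case (Cons x ws)
    then have "x \<in> generated T" "- x \<in> generated T"
      using assms(1) generated_uminus[of T x] generator_in_generated[of x T] by auto
    then have "conjugate x r \<in> generated T" if "r \<in> generated T" for r
      using that unfolding conjugate_def diff_conv_add_uminus by (intro generated_add)
    then show ?case
      using Cons \<open>x \<in> generated T\<close> by auto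
  qed simp
  moreover obtain ws where "ws \<in> lists T" "sum_list ws = w"
    using assms(2) by (rule generatedE)
  moreover have "ws \<in> lists S"
    using assms(1) calculation(2) by auto
  ultimately show ?thesis
    using inversions_sum_list odd_refls_subset by blast
qed

section \<open>Minimal representatives of cosets of parabolic subgroups\<close>

definition coset_reps :: "'w set \<Rightarrow> 'w set" where
  "coset_reps T = {u. \<forall>v \<in> generated T. len u \<le> len (u + v)}"

text \<open>A common element \<open>conjugate u r\<close> would give \<open>u + r\<close>, a shorter
  member of the same coset. The symmetric difference of \<open>inversions_add\<close> is therefore a
  disjoint union.\<close>

lemma inversions_coset_rep:
  assumes "T \<subseteq> S" "u \<in> coset_reps T" "v \<in> generated T"
  shows "inversions (u + v) = inversions u \<union> conjugate u ` inversions v"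
    and "inversions u \<inter> conjugate u ` inversions v = {}"
proof -
  show disj: "inversions u \<inter> conjugate u ` inversions v = {}"
  proof (rule ccontr)
    assume "inversions u \<inter> conjugate u ` inversions v \<noteq> {}"
    then obtain r where r: "conjugate u r \<in> inversions u" "r \<in> inversions v"
      by auto
    then have "len (u + r) < len u"
      using len_inversion_less[of "conjugate u r" u] by simp
    moreover have "r \<in> generated T"
      using r inversions_generated[OF assms(1,3)] by auto
    ultimately show False
      using assms(2) unfolding coset_reps_def by force
  qed
  have "x \<in> conjugate u ` inversions v \<longleftrightarrow> conjugate (- u) x \<in> inversions v" for x
    by (metis conjugate_minus_cancel image_iff)
  then show "inversions (u + v) = inversions u \<union> conjugate u ` inversions v"
    using disj inversions_add[of _ u v] by blast
qed

lemma len_coset_rep: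
  assumes "T \<subseteq> S" "u \<in> coset_reps T" "v \<in> generated T"
  shows "len (u + v) = len u + len v"
  using inversions_coset_rep[OF assms] unfolding len_def
  by (simp add: card_Un_disjoint card_image inj_on_subset[OF inj_conjugate])

lemma ex_coset_rep:
  assumes "T \<subseteq> S"
  shows "\<exists>u \<in> coset_reps T. \<exists>v \<in> generated T. w = u + v"
proof -
  obtain v where v: "v \<in> generated T" and min: "\<And>v'. v' \<in> generated T \<Longrightarrow> len (w + v) \<le> len (w + v')"
    using ex_has_least_nat[of "\<lambda>v. v \<in> generated T" 0 "\<lambda>v. len (w + v)"] by auto
  have "w + v \<in> coset_reps T"
    unfolding coset_reps_def using min generated_add[OF v] by (auto simp: add.assoc)
  moreover have "w = (w + v) + - v"
    by (simp add: add.assoc)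
  ultimately show ?thesis
    using generated_uminus[OF assms v] by blast
qed

text \<open>Lengths add in passing from \<open>u\<close> to \<open>u'\<close> and back, so the
  difference \<open>x\<close> has length 0.\<close>

lemma coset_rep_unique:
  assumes T: "T \<subseteq> S" and u: "u \<in> coset_reps T" "u' \<in> coset_reps T"
    and v: "v \<in> generated T" "v' \<in> generated T" and eq: "u + v = u' + v'"
  shows "u = u' \<and> v = v'"
proof -
  define x where "x = v + - v'"
  have x: "x \<in> generated T" "- x \<in> generated T"
    unfolding x_def using v generated_uminus[OF T] generated_add by blast+
  have "u' = u + x"
    using eq unfolding x_def by (metis add.assoc add.right_inverse add.right_neutral)
  then have "len u' = len u + len x" "len u = len u' + len (- x)"
    using len_coset_rep[OF T u(1) x(1)] len_coset_rep[OF T u(2) x(2)] by (simp_all add: add.assoc)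
  then have "x = 0" by simp
  then show ?thesis
    using \<open>u' = u + x\<close> eq by simp
qed

section \<open>Descents and finiteness\<close>

definition descents :: "'w \<Rightarrow> 'w set" where
  "descents w = {s \<in> S. len (w + s) < len w}"

text \<open>For the converse, split \<open>w = u + v\<close> at the coset: if \<open>v\<close> is
  nonzero, the last letter of a reduced word for \<open>v\<close> is a descent of \<open>w\<close>
  in \<open>T\<close>.\<close>

lemma coset_reps_iff_descents:
  assumes "T \<subseteq> S"
  shows "w \<in> coset_reps T \<longleftrightarrow> T \<inter> descents w = {}"
proof
  assume "w \<in> coset_reps T"
  then show "T \<inter> descents w = {}"
    using generator_in_generated[of _ T] by (force simp: coset_reps_def descents_def)
next
  assume nd: "T \<inter> descents w = {}"
  obtain u v where uv: "u \<in> coset_reps T" "v \<in> generated T" "w = u + v"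
    using ex_coset_rep[OF assms] by blast
  obtain vs where vs: "vs \<in> lists T" "sum_list vs = v" "length vs = len v"
    using ex_short_word[OF assms uv(2)] by blast
  show "w \<in> coset_reps T"
  proof (cases vs rule: rev_cases)
    case Nil
    then show ?thesis using uv vs by simp
  next
    case (snoc xs s)
    have s: "s \<in> T" "s \<in> S" and xs: "xs \<in> lists T"
      using vs snoc assms by auto
    then have "v + s = sum_list xs"
      using vs(2) snoc involution[of s] by (simp flip: vs(2) add: add.assoc)
    then have "len (w + s) = len u + len (sum_list xs)"
      using len_coset_rep[OF assms uv(1) generatedI[OF xs]] uv(3) by (simp add: add.assoc)
    also have "\<dots> < len u + len v"
      using len_sum_list_le[of xs] xs assms vs(3) snoc by (force simp: subset_iff)
    also have "\<dots> = len w"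
      using len_coset_rep[OF assms uv(1,2)] uv(3) by simp
    finally show ?thesis
      using nd s by (auto simp: descents_def)
  qed
qed

lemma inversions_uminus: "r \<in> inversions (- w) \<longleftrightarrow> conjugate w r \<in> inversions w"
  using inversions_add[of "conjugate w r" w "- w"] by simp

lemma len_uminus: "len (- w) = len w"
proof -
  have "conjugate w ` inversions (- w) = inversions w"
    using inversions_uminus by (auto simp: image_iff) (metis conjugate_minus_cancel(2))
  then show ?thesis
    unfolding len_def by (metis card_image inj_conjugate inj_on_subset subset_UNIV)
qed

text \<open>An element with all of \<open>T\<close> as descents has every element of the parabolic subgroup as a suffix.\<close>

lemma finite_generated_if_descents:
  assumes fin: "finite S" and T: "T \<subseteq> descents w"
  shows "finite (generated T)"
proof -
  \<comment> \<open>Inversion turns right descents of \<open>w\<close> into left ones of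
    \<open>x\<close>, which inversion sets can see.\<close>
  define x where "x = - w"
  have TS: "T \<subseteq> S"
    using T by (auto simp: descents_def)
  \<comment> \<open>Exactly one of \<open>x\<close> and \<open>s + x\<close> has \<open>s\<close> as
    an inversion, and that one is the longer.\<close>
  have desc: "s \<in> inversions x" if "s \<in> T" for s
  proof (rule ccontr)
    assume no: "s \<notin> inversions x"
    have s: "s \<in> S" "len (w + s) < len w"
      using that T by (auto simp: descents_def)
    have "- (w + s) = s + x"
      using minus_generator[OF s(1)] by (simp add: x_def minus_add del: add_uminus_conv_diff)
    then have less: "len (s + x) < len x"
      using s(2) len_uminus[of "w + s"] len_uminus[of w] by (simp add: x_def)
    have "conjugate (- s) s = s"
      by (simp add: conjugate_def)
    then have "s \<in> inversions (s + x)"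
      using no inversions_add[of s s x] inversions_generator[OF s(1)] by simp
    then have "len (s + (s + x)) < len (s + x)"
      by (rule len_inversion_less)
    then show False
      using less involution[OF s(1)] by (simp flip: add.assoc)
  qed
  have "len x = len v + len (- v + x)" if "v \<in> generated T" for v
  proof -
    obtain vs where "vs \<in> lists T" "sum_list vs = v" "distinct (refls vs)"
      using ex_short_word[OF TS \<open>v \<in> generated T\<close>] by blast
    moreover have "vs \<in> lists T \<Longrightarrow> distinct (refls vs) \<Longrightarrow>
        len x = len (sum_list vs) + len (- sum_list vs + x)" for vs
    proof (induction vs)
      case (Cons s vs)
      define v y where "v = sum_list vs" and "y = - v + x"
      have s: "s \<in> T" "s \<in> S" and vs: "vs \<in> lists T" "vs \<in> lists S"
        using Cons.prems TS by auto
      have "distinct (refls vs)"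
        using Cons.prems by (simp add: distinct_map)
      then have len_x: "len x = len v + len y"
        using Cons vs by (simp add: v_def y_def)
      have "conjugate s s = s"
        by (simp add: conjugate_def)
      then have "s \<notin> set (refls vs)"
        using Cons.prems by (auto simp: image_iff)
      then have "s \<notin> inversions v"
        using inversions_sum_list[OF vs(2)] odd_refls_subset unfolding v_def by blast
      moreover have "x = v + y"
        by (simp add: y_def flip: add.assoc)
      \<comment> \<open>The inversion \<open>s\<close> of \<open>x = v + y\<close> is not one of
        \<open>v\<close>, so it comes from \<open>y\<close>. Moving \<open>s\<close> over to
        \<open>v\<close> thus shortens \<open>y\<close>, and subadditivity of length forces
        equality.\<close>
      ultimately have "conjugate (- v) s \<in> inversions y"
        using desc[OF s(1)] inversions_add by metis
      then have "len (conjugate (- v) s + y) < len y"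
        by (rule len_inversion_less)
      moreover have "conjugate (- v) s + y = - (s + v) + x"
        using minus_generator[OF s(2)]
        by (simp add: y_def conjugate_def minus_add add.assoc diff_conv_add_uminus del: add_uminus_conv_diff)
      moreover have "len x \<le> len (s + v) + len (- (s + v) + x)"
        using len_add_le[of "s + v" "- (s + v) + x"] by (metis add.assoc add.right_inverse add.left_neutral)
      moreover have "len (s + v) \<le> 1 + len v"
        using len_add_le[of s v] s(2) by (simp add: len_def inversions_generator)
      ultimately show ?case
        using len_x by (simp add: v_def)
    qed simp
    ultimately show ?thesis by blast
  qed
  \<comment> \<open>Lengths in \<open>generated T\<close> are bounded by \<open>len x\<close>, and a
    finite alphabet has finitely many such words.\<close>
  then have "generated T \<subseteq> sum_list ` {ws. set ws \<subseteq> S \<and> length ws \<le> len x}"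
    using ex_short_word[OF TS] TS by (fastforce simp: image_iff Bex_def)
  moreover have "finite {ws. set ws \<subseteq> S \<and> length ws \<le> len x}"
    using fin by (rule finite_lists_length_le)
  ultimately show ?thesis
    by (meson finite_imageI finite_subset)
qed

end

section \<open>Growth series of parabolic subgroups\<close>

locale labelled_coxeter = coxeter S m
  for S :: "'w::group_add set" and m :: "'w \<Rightarrow> 'w \<Rightarrow> enat" +
  fixes i :: "'w \<Rightarrow> 'i"
  assumes finite_S: "finite S"
    and conj_label: "\<And>s s'. s \<in> S \<Longrightarrow> s' \<in> S \<Longrightarrow> group_conj s s' \<Longrightarrow> i s = i s'"
begin

text \<open>Extends \<open>i\<close> to all reflections; constancy on conjugacy classes makes the
  chosen generator irrelevant.\<close>

definition label :: "'w \<Rightarrow> 'i" where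
  "label r = i (SOME s. s \<in> S \<and> group_conj s r)"

lemma label_conjugate [simp]: "label (conjugate g r) = label r"
  by (simp add: label_def group_conj_conjugate)

lemma label_generator: "s \<in> S \<Longrightarrow> label s = i s"
  unfolding label_def
  using someI[of "\<lambda>s'. s' \<in> S \<and> group_conj s' s" s] conj_label group_conj_refl by blast

text \<open>This description of \<open>t\<^sup>w\<close> shows that it does not depend on the reduced expression.\<close>

lemma t_exp_eq: "t_exp S i w = (\<Sum>r\<in>inversions w. Poly_Mapping.single (label r) 1)"
proof -
  define ws where "ws = (SOME ws. reduced_expression S w ws)"
  have ws: "ws \<in> lists S" "sum_list ws = w"
    and min: "\<And>vs. vs \<in> lists S \<Longrightarrow> sum_list vs = w \<Longrightarrow> length ws \<le> length vs"
    using someI_ex[OF ex_reduced_expression[OF coxeter_system, of w]]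
    unfolding ws_def reduced_expression_def by blast+
  have d: "distinct (refls ws)"
    using shorten_word[OF subset_refl ws(1)] min ws(2) by fastforce
  \<comment> \<open>Each entry of \<open>refls ws\<close> is conjugate to the letter at its
    position.\<close>
  have "map i ws = map label (refls ws)"
    using ws(1)
  proof (induction ws)
    case (Cons x xs)
    then show ?case
      by (simp add: label_generator o_def)
  qed simp
  then have "map (\<lambda>s. Poly_Mapping.single (i s) (1::nat)) ws =
      map (\<lambda>r. Poly_Mapping.single (label r) 1) (refls ws)"
    using map_map[of "\<lambda>j. Poly_Mapping.single j (1::nat)" i ws]
      map_map[of "\<lambda>j. Poly_Mapping.single j (1::nat)" label "refls ws"] by (simp add: o_def)
  then have "t_exp S i w = sum_list (map (\<lambda>r. Poly_Mapping.single (label r) 1) (refls ws))"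
    by (simp add: t_exp_def ws_def)
  also have "\<dots> = (\<Sum>r\<in>inversions w. Poly_Mapping.single (label r) 1)"
    using d ws inversions_sum_list[of ws] odd_refls_distinct[of ws]
    by (simp add: sum_list_distinct_conv_sum_set)
  finally show ?thesis .
qed

text \<open>The inversions form a disjoint union, and \<open>label\<close> ignores the conjugation
  by \<open>u\<close>.\<close>

lemma t_exp_coset_rep:
  assumes "T \<subseteq> S" "u \<in> coset_reps T" "v \<in> generated T"
  shows "t_exp S i (u + v) = t_exp S i u + t_exp S i v"
  unfolding t_exp_eq inversions_coset_rep(1)[OF assms]
  using inversions_coset_rep(2)[OF assms]
  by (simp add: sum.union_disjoint sum.reindex inj_on_subset[OF inj_conjugate])

lemma t_exp_eq_0_iff: "t_exp S i w = 0 \<longleftrightarrow> w = 0"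
proof -
  have "total_degree (\<Sum>r\<in>A. Poly_Mapping.single (label r) 1) = card A" if "finite A" for A
    using that by (induction A) (auto simp: total_degree_add)
  then have "total_degree (t_exp S i w) = len w"
    by (simp add: t_exp_eq len_def)
  then show ?thesis
    by (metis len_eq_0_iff total_degree_eq_0_iff)
qed

lemma finite_t_exp [simp]: "finite {w. t_exp S i w = e}" "finite {w \<in> A. t_exp S i w = e}"
  using growth_locally_finite[OF coxeter_system finite_S, of i e] by simp_all

end

text \<open>Treats both series at once: \<open>c\<close> is a multiplicative weight, constantly 1
  for the growth series and the basis element of \<open>w\<close> in the group ring for the complete
  one.\<close>

locale weighted_coxeter = labelled_coxeter S m i
  for S :: "'w::group_add set" and m :: "'w \<Rightarrow> 'w \<Rightarrow> enat" and i :: "'w \<Rightarrow> 'i" +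
  fixes c :: "'w \<Rightarrow> 'r::ring_1"
  assumes c_zero: "c 0 = 1" and c_add: "c (u + v) = c u * c v"
begin

definition series :: "'w set \<Rightarrow> ('i, 'r) mps" where
  "series A = Abs_mps (\<lambda>e. \<Sum>w\<in>{w \<in> A. t_exp S i w = e}. c w)"

lemma mps_Sum_eq_series: "mps_Sum (\<lambda>w. mps_monom (c w) (t_exp S i w)) = series UNIV"
proof (rule mps_eqI)
  fix e
  have "Sum_any (\<lambda>w. if e = t_exp S i w then c w else 0) =
      (\<Sum>w\<in>{w. t_exp S i w = e}. if e = t_exp S i w then c w else 0)"
    by (rule Sum_any.expand_superset) auto
  then show "mps_coeff (mps_Sum (\<lambda>w. mps_monom (c w) (t_exp S i w))) e = mps_coeff (series UNIV) e"
    by (simp add: mps_Sum_def mps_monom_def series_def cong: sum.cong_simp)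
qed

lemma mps_coeff_series: "mps_coeff (series A) e = (\<Sum>w\<in>{w \<in> A. t_exp S i w = e}. c w)"
  by (simp add: series_def)

lemma series_0: "0 \<in> A \<Longrightarrow> mps_coeff (series A) 0 = 1"
proof -
  assume "0 \<in> A"
  then have "{w \<in> A. t_exp S i w = 0} = {0}"
    by (auto simp: t_exp_eq_0_iff)
  then show ?thesis
    by (simp add: mps_coeff_series c_zero)
qed

lemma rational_series_finite:
  assumes "finite A"
  shows "rational_series (series A)"
proof (rule rational_finite_support)
  have "mps_coeff (series A) e = 0" if "e \<notin> t_exp S i ` A" for e
  proof -
    have "{w \<in> A. t_exp S i w = e} = {}"
      using that by auto
    then show ?thesis
      unfolding mps_coeff_series by (simp only: sum.empty)
  qed
  then have "{e. mps_coeff (series A) e \<noteq> 0} \<subseteq> t_exp S i ` A"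
    by blast
  then show "finite {e. mps_coeff (series A) e \<noteq> 0}"
    using assms by (meson finite_imageI finite_subset)
qed

text \<open>The unique factorisation \<open>w = u + v\<close> respects weights and monomials.
  Representatives stand on the left because the weights need not commute.\<close>

lemma series_coset_reps:
  assumes "T \<subseteq> U" "U \<subseteq> S"
  shows "series (generated U \<inter> coset_reps T) * series (generated T) = series (generated U)"
proof (rule mps_eqI)
  fix e
  have T: "T \<subseteq> S"
    using assms by auto
  let ?F = "\<lambda>a. {w \<in> generated U \<inter> coset_reps T. t_exp S i w = a}"
  let ?G = "\<lambda>b. {w \<in> generated T. t_exp S i w = b}"
  \<comment> \<open>The splitting is determined by the exponents of the two elements, so forgetting
    it keeps the map injective.\<close>
  let ?P = "SIGMA p : splittings e. ?F (fst p) \<times> ?G (snd p)"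
  have bij: "bij_betw (\<lambda>(p, u, v). u + v) ?P {w \<in> generated U. t_exp S i w = e}"
    unfolding bij_betw_def
  proof
    show "inj_on (\<lambda>(p, u, v). u + v) ?P"
    proof (rule inj_onI, clarsimp)
      fix u v u' v'
      assume "u \<in> coset_reps T" "v \<in> generated T" "u' \<in> coset_reps T" "v' \<in> generated T"
        "u + v = u' + v'"
      then have "u = u' \<and> v = v'"
        using coset_rep_unique[OF T] by blast
      then show "t_exp S i u = t_exp S i u' \<and> t_exp S i v = t_exp S i v' \<and> u = u' \<and> v = v'"
        by simp
    qed
    have "w \<in> (\<lambda>(p, u, v). u + v) ` ?P" if "w \<in> generated U" "t_exp S i w = e" for w
    proof -
      obtain u v where uv: "u \<in> coset_reps T" "v \<in> generated T" "w = u + v"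
        using ex_coset_rep[OF T] by blast
      have "- v \<in> generated U"
        using generated_uminus[OF T uv(2)] generated_mono[OF assms(1)] by blast
      then have "w + - v \<in> generated U"
        by (rule generated_add[OF that(1)])
      then have "u \<in> generated U"
        by (simp add: uv(3) add.assoc)
      then have "((t_exp S i u, t_exp S i v), u, v) \<in> ?P"
        using uv that(2) t_exp_coset_rep[OF T uv(1,2)] by (simp add: splittings_def)
      then show ?thesis
        using uv(3) by (force intro: image_eqI[rotated])
    qed
    moreover have "(\<lambda>(p, u, v). u + v) ` ?P \<subseteq> {w \<in> generated U. t_exp S i w = e}"
      using generated_add generated_mono[OF assms(1)] t_exp_coset_rep[OF T]
      by (auto simp: splittings_def)
    ultimately show "(\<lambda>(p, u, v). u + v) ` ?P = {w \<in> generated U. t_exp S i w = e}"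
      by blast
  qed
  have "mps_coeff (series (generated U \<inter> coset_reps T) * series (generated T)) e =
      (\<Sum>p\<in>splittings e. \<Sum>q\<in>?F (fst p) \<times> ?G (snd p). c (fst q + snd q))"
    by (simp add: mps_coeff_times mps_coeff_series sum_product sum.cartesian_product c_add split_def)
  also have "\<dots> = (\<Sum>x\<in>?P. c (fst (snd x) + snd (snd x)))"
    by (subst sum.Sigma) (auto simp: split_def)
  also have "\<dots> = (\<Sum>w\<in>{w \<in> generated U. t_exp S i w = e}. c w)"
    using sum.reindex_bij_betw[OF bij, of c] by (simp add: split_def)
  finally show "mps_coeff (series (generated U \<inter> coset_reps T) * series (generated T)) e =
      mps_coeff (series (generated U)) e"
    by (simp add: mps_coeff_series)
qed

section \<open>Alternating sums and induction over subsets of generators\<close>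

text \<open>After exchanging the sums, each \<open>w\<close> collects the signs of all subsets of
  \<open>U - descents w\<close>, which is nonempty by assumption.\<close>

lemma alternating_sum_coset_reps:
  assumes "U \<subseteq> S" and no_longest: "\<And>w. w \<in> generated U \<Longrightarrow> \<not> U \<subseteq> descents w"
  shows "(\<Sum>T\<in>Pow U. (- 1) ^ card T * series (generated U \<inter> coset_reps T)) = 0"
proof (rule mps_eqI)
  fix e
  let ?W = "{w \<in> generated U. t_exp S i w = e}"
  have U: "finite U"
    using assms(1) finite_S finite_subset by blast
  have "mps_coeff (series (generated U \<inter> coset_reps T)) e =
      (\<Sum>w\<in>?W. if T \<subseteq> U - descents w then c w else 0)" if "T \<subseteq> U" for T
  proof -
    have "T \<subseteq> S"
      using that assms(1) by blast
    then have "{w \<in> generated U \<inter> coset_reps T. t_exp S i w = e} = {w \<in> ?W. T \<subseteq> U - descents w}"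
      using coset_reps_iff_descents that by blast
    then show ?thesis
      unfolding mps_coeff_series by (simp only: sum.inter_filter[OF finite_t_exp(2)])
  qed
  then have "mps_coeff (\<Sum>T\<in>Pow U. (- 1) ^ card T * series (generated U \<inter> coset_reps T)) e =
      (\<Sum>T\<in>Pow U. \<Sum>w\<in>?W. if T \<subseteq> U - descents w then (- 1) ^ card T * c w else 0)"
    by (auto simp: mps_coeff_sum mps_coeff_sign_times sum_distrib_left intro!: sum.cong)
  also have "\<dots> = (\<Sum>w\<in>?W. \<Sum>T\<in>Pow U. if T \<subseteq> U - descents w then (- 1) ^ card T * c w else 0)"
    by (rule sum.swap)
  also have "\<dots> = (\<Sum>w\<in>?W. 0)"
  proof (rule sum.cong[OF HOL.refl])
    fix w assume w: "w \<in> ?W"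
    have "(\<Sum>T\<in>Pow U. if T \<subseteq> U - descents w then (- 1) ^ card T * c w else 0) =
        (\<Sum>T\<in>{T \<in> Pow U. T \<subseteq> U - descents w}. (- 1) ^ card T * c w)"
      using U by (intro sum.inter_filter[symmetric]) simp
    also have "{T \<in> Pow U. T \<subseteq> U - descents w} = Pow (U - descents w)"
      by auto
    also have "(\<Sum>T\<in>Pow (U - descents w). (- 1) ^ card T * c w) = 0"
      using sum_sign_Pow[of "U - descents w", where ?'r = 'r] no_longest[of w] w U
      by (simp flip: sum_distrib_right)
    finally show "(\<Sum>T\<in>Pow U. if T \<subseteq> U - descents w then (- 1) ^ card T * c w else 0) = 0" .
  qed
  finally show "mps_coeff (\<Sum>T\<in>Pow U. (- 1) ^ card T * series (generated U \<inter> coset_reps T)) e =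
      mps_coeff 0 e"
    by simp
qed

lemma coset_reps_full: "U \<subseteq> S \<Longrightarrow> generated U \<inter> coset_reps U = {0}"
proof
  assume U: "U \<subseteq> S"
  show "generated U \<inter> coset_reps U \<subseteq> {0}"
  proof
    fix w assume w: "w \<in> generated U \<inter> coset_reps U"
    then have "- w \<in> generated U"
      using generated_uminus[OF U] by blast
    then have "len w \<le> len (w + - w)"
      using w unfolding coset_reps_def by blast
    then show "w \<in> {0}" by simp
  qed
qed (simp add: coset_reps_def)

lemma rational_generated:
  assumes "U \<subseteq> S"
  shows "rational_series (series (generated U))"
proof -
  have "finite U"
    using assms finite_S finite_subset by blast
  then show ?thesis
    using assms
  proof (induction U rule: finite_psubset_induct)
    case (psubset U)
    show ?case
    proof (cases "\<exists>w \<in> generated U. U \<subseteq> descents w")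
      case True
      then show ?thesis
        using finite_generated_if_descents[OF finite_S] rational_series_finite by blast
    next
      case False
      have "\<exists>g. rational_series g \<and> series (generated T) * g = 1" if "T \<in> Pow U - {U}" for T
      proof (rule rational_inverse)
        show "rational_series (series (generated T))"
          using psubset that by blast
      qed (auto simp: series_0)
      then obtain g where g: "\<And>T. T \<in> Pow U - {U} \<Longrightarrow> rational_series (g T)"
        "\<And>T. T \<in> Pow U - {U} \<Longrightarrow> series (generated T) * g T = 1"
        by metis
      \<comment> \<open>Obtained by isolating the term \<open>T = U\<close> of the alternating sum,
        which is the bare sign, and solving for a right inverse of \<open>?f\<close>.\<close>
      define X where "X = - ((- 1) ^ card U * (\<Sum>T\<in>Pow U - {U}. (- 1) ^ card T * g T))"
      let ?f = "series (generated U)"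
      let ?R = "\<lambda>T. series (generated U \<inter> coset_reps T)"
      have R: "?R T = ?f * g T" if "T \<in> Pow U - {U}" for T
      proof -
        have "?f * g T = ?R T * (series (generated T) * g T)"
          using series_coset_reps[of T U] that psubset.prems by (simp flip: mult.assoc)
        then show ?thesis
          using g(2)[OF that] by simp
      qed
      \<comment> \<open>Signs are central even though the coefficients need not commute.\<close>
      have comm: "x * (- 1) ^ k = (- 1) ^ k * x" for x :: "('i, 'r) mps" and k
        by (induction k) (simp_all add: mult.assoc)
      have R_U: "?R U = 1"
      proof -
        have "?R U = series {0}"
          by (simp add: coset_reps_full[OF psubset.prems])
        moreover have "{w \<in> {0}. t_exp S i w = e} = (if e = 0 then {0} else {})" for e
          using t_exp_eq_0_iff by force
        ultimately show ?thesis
          by (intro mps_eqI) (simp add: mps_coeff_series c_zero)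
      qed
      have "0 = (\<Sum>T\<in>Pow U. (- 1) ^ card T * ?R T)"
        using alternating_sum_coset_reps[OF psubset.prems] False by metis
      also have "\<dots> = (- 1) ^ card U * ?R U + (\<Sum>T\<in>Pow U - {U}. (- 1) ^ card T * ?R T)"
        using psubset.hyps by (intro sum.remove) auto
      also have "(\<Sum>T\<in>Pow U - {U}. (- 1) ^ card T * ?R T) =
          ?f * (\<Sum>T\<in>Pow U - {U}. (- 1) ^ card T * g T)"
        unfolding sum_distrib_left by (rule sum.cong) (simp_all add: R comm flip: mult.assoc)
      finally have eq: "?f * (\<Sum>T\<in>Pow U - {U}. (- 1) ^ card T * g T) = - ((- 1) ^ card U)"
        by (simp add: R_U add_eq_0_iff)
      have "?f * X = - ((- 1) ^ card U * (?f * (\<Sum>T\<in>Pow U - {U}. (- 1) ^ card T * g T)))"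
        unfolding X_def by (simp add: comm flip: mult.assoc)
      also have "\<dots> = 1"
        unfolding eq by (simp flip: power_add mult_2)
      finally have fX: "?f * X = 1" .
      have "rational_series X"
        unfolding X_def
        by (intro rational_uminus rational_series.mult rational_sum rational_sign g(1))
      moreover have "mps_coeff X 0 = 1"
        using arg_cong[OF fX, of "\<lambda>h. mps_coeff h 0"] by (simp add: mps_coeff_times_0 series_0)
      \<comment> \<open>\<open>X\<close> is rational and has right inverse \<open>Y\<close>, so
        \<open>?f = ?f * X * Y = Y\<close> is rational.\<close>
      ultimately obtain Y where Y: "rational_series Y" "X * Y = 1"
        by (rule rational_inverse)
      have "?f = ?f * X * Y"
        using Y(2) by (simp add: mult.assoc)
      then show ?thesis
        using Y(1) fX by simp
    qed
  qed
qed

lemma rational_weighted_sum: "rational_series (mps_Sum (\<lambda>w. mps_monom (c w) (t_exp S i w)))"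
  using rational_generated[OF subset_refl] by (simp add: mps_Sum_eq_series generated_UNIV)

end

theorem corollary9p1:
  fixes S :: "'w::group_add set"
    and m :: "'w \<Rightarrow> 'w \<Rightarrow> enat"
    and i :: "'w \<Rightarrow> 'i"
  assumes "coxeter_system S m"
    and "finite S"
    and "\<And>s s'. s \<in> S \<Longrightarrow> s' \<in> S \<Longrightarrow> group_conj s s' \<Longrightarrow> i s = i s'"
  shows "rational_series (growth_series S i) \<and> rational_series (complete_growth_series S i)"
proof
  interpret labelled_coxeter S m i
    using assms by unfold_locales
  interpret plain: weighted_coxeter S m i "\<lambda>_. 1 :: rat"
    by unfold_locales simp_all
  \<comment> \<open>Convolution multiplies basis elements by the group operation, so this weight is
    multiplicative.\<close>
  interpret complete: weighted_coxeter S m i "\<lambda>w. Poly_Mapping.single w (1 :: rat)"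
    by unfold_locales (simp_all add: mult_single)
  show "rational_series (growth_series S i)"
    unfolding growth_series_def by (rule plain.rational_weighted_sum)
  show "rational_series (complete_growth_series S i)"
    unfolding complete_growth_series_def by (rule complete.rational_weighted_sum)
qed

end
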